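(* Let $I$ be a real interval and let $f : I \to F(\mathbb{R})$ be a fuzzy-valued function. If $f$ is Seikkala differentiable (S-differentiable) on $I$, then $f$ is generalized Seikkala differentiable (gS-differentiable) on $I$.
   Context: Fuzzy numbers: a function $a : \mathbb{R} \to [0,1]$ is a fuzzy number if there is some $r_0 \in \mathbb{R}$ with $a(r_0)=1$, $a$ is quasi-concave and upper semicontinuous on $\mathbb{R}$, and the closure of $\{r \in \mathbb{R} : a(r) > 0\}$ is compact. The set of fuzzy numbers is denoted $F(\mathbb{R})$. For $a \in F(\mathbb{R})$ the $\alpha$-level set is $a_\alpha = \{r \in \mathbb{R} : a(r) \ge \alpha\}$ for $\alpha \in (0,1]$, and $a_0$ is the closure of $\{r \in \mathbb{R} : a(r) > 0\}$. Each $a_\alpha$ is a compact interval, written $a_\alpha = [a_1(\alpha), a_2(\alpha)]$. A fuzzy-valued function on $I$ is a map $f : I \to F(\mathbb{R})$; its $\alpha$-level sets are written $f_\alpha(t) = (f(t))_\alpha = [f_1(t,\alpha), f_2(t,\alpha)]$ for $t \in I$, $\alpha \in [0,1]$. Derivatives $f_i'(t,\alpha)$ are with respect to $t$ for fixed $\alpha$. A family of sets indexed by $\alpha \in [0,1]$ "defines a fuzzy number" if there is a fuzzy number $u \in F(\mathbb{R})$ whose $\alpha$-level set $u_\alpha$ is the given set for every $\alpha \in [0,1]$. Seikkala differentiability: $f$ is Seikkala differentiable (S-differentiable) on $I$ if $f_1'(t,\alpha)$ and $f_2'(t,\alpha)$ exist for all $t \in I$ and each $\alpha \in [0,1]$ and,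 for each fixed $t \in I$, the family $[f_1'(t,\alpha), f_2'(t,\alpha)]$, $\alpha \in [0,1]$, defines a fuzzy number; this fuzzy number is the Seikkala derivative of $f$ at $t$. Generalized Seikkala differentiability: $f$ is gS-differentiable on $I$ if $f_1(t,\alpha)$ and $f_2(t,\alpha)$ are differentiable in $t$ for each $t \in I$ (and each $\alpha \in [0,1]$) and the family $[\min\{f_1'(t,\alpha), f_2'(t,\alpha)\}, \max\{f_1'(t,\alpha), f_2'(t,\alpha)\}]$, $\alpha \in [0,1]$, defines a fuzzy number for each $t \in I$; this fuzzy number is the gS-derivative $f'(t)$. *)

theory Defs
  imports "HOL-Analysis.Analysis"
begin

section \<open>Fuzzy numbers\<close>

definition quasi_concave :: "(real \<Rightarrow> real) \<Rightarrow> bool" where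
  "quasi_concave a \<longleftrightarrow>
     (\<forall>x y. \<forall>u\<in>{0..1}. min (a x) (a y) \<le> a ((1 - u) * x + u * y))"

definition upper_semicontinuous :: "(real \<Rightarrow> real) \<Rightarrow> bool" where
  "upper_semicontinuous a \<longleftrightarrow> (\<forall>x c. a x < c \<longrightarrow> (\<forall>\<^sub>F y in nhds x. a y < c))"

definition fuzzy_numbers :: "(real \<Rightarrow> real) set" where
  "fuzzy_numbers =
     {a. range a \<subseteq> {0..1} \<and> (\<exists>r. a r = 1) \<and> quasi_concave a \<and>
         upper_semicontinuous a \<and> compact (closure {r. a r > 0})}"

text \<open>Only the values of \<open>level a \<alpha>\<close> for \<open>\<alpha> \<in> {0..1}\<close> are meaningful.\<close>

definition level :: "(real \<Rightarrow> real) \<Rightarrow> real \<Rightarrow> real set" where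
  "level a \<alpha> = (if \<alpha> = 0 then closure {r. a r > 0} else {r. a r \<ge> \<alpha>})"

definition lower_end :: "(real \<Rightarrow> real) \<Rightarrow> real \<Rightarrow> real" where
  "lower_end a \<alpha> = Inf (level a \<alpha>)"

definition upper_end :: "(real \<Rightarrow> real) \<Rightarrow> real \<Rightarrow> real" where
  "upper_end a \<alpha> = Sup (level a \<alpha>)"

lemma level_eq_interval:
  assumes "a \<in> fuzzy_numbers" "\<alpha> \<in> {0..1}"
  shows "level a \<alpha> = {lower_end a \<alpha>..upper_end a \<alpha>}" "lower_end a \<alpha> \<le> upper_end a \<alpha>"
proof -
  have qc: "quasi_concave a" and usc: "upper_semicontinuous a"
    and cpt: "compact (closure {r. a r > 0})" and "\<exists>r. a r = 1"
    using assms(1) by (auto simp: fuzzy_numbers_def)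
  then obtain r where r: "a r = 1" by blast
  have conv: "convex {r. P (a r)}" if mono: "\<And>x y. P x \<Longrightarrow> x \<le> y \<Longrightarrow> P y" for P
  proof (rule convexI)
    fix x y u v :: real
    assume *: "x \<in> {r. P (a r)}" "y \<in> {r. P (a r)}" "0 \<le> u" "0 \<le> v" "u + v = 1"
    then have u: "u = 1 - v" by simp
    have "min (a x) (a y) \<le> a (u * x + v * y)"
      using qc * unfolding quasi_concave_def u by auto
    moreover have "P (min (a x) (a y))" using * by (auto simp: min_def)
    ultimately show "u *\<^sub>R x + v *\<^sub>R y \<in> {r. P (a r)}" using mono by auto
  qed
  have "compact (level a \<alpha>) \<and> convex (level a \<alpha>) \<and> r \<in> level a \<alpha>"
  proof (cases "\<alpha> = 0")
    case True
    have "r \<in> closure {r. a r > 0}" using r closure_subset[of "{r. a r > 0}"] by force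
    then show ?thesis using True cpt conv[of "\<lambda>x. x > 0"] by (simp add: level_def convex_closure)
  next
    case False
    have "open {r. a r < \<alpha>}"
    proof (subst open_subopen, intro ballI)
      fix x assume "x \<in> {r. a r < \<alpha>}"
      then have "\<forall>\<^sub>F y in nhds x. a y < \<alpha>"
        using usc by (simp add: upper_semicontinuous_def)
      then show "\<exists>T. open T \<and> x \<in> T \<and> T \<subseteq> {r. a r < \<alpha>}"
        unfolding eventually_nhds by blast
    qed
    moreover have "{r. a r \<ge> \<alpha>} = - {r. a r < \<alpha>}" by auto
    ultimately have "closed {r. a r \<ge> \<alpha>}" by auto
    moreover have "{r. a r \<ge> \<alpha>} \<subseteq> closure {r. a r > 0}"
      using False assms(2) closure_subset[of "{r. a r > 0}"] by auto
    ultimately have "compact {r. a r \<ge> \<alpha>}"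
      using closed_Int_compact[OF _ cpt, of "{r. a r \<ge> \<alpha>}"] by (simp only: Int_absorb2)
    then show ?thesis
      using False r assms(2) conv[of "\<lambda>x. x \<ge> \<alpha>"] by (simp add: level_def)
  qed
  then have "connected (level a \<alpha>)" "compact (level a \<alpha>)" and mem: "r \<in> level a \<alpha>"
    by (simp_all add: convex_connected)
  then obtain l u where lu: "level a \<alpha> = {l..u}"
    using connected_compact_interval_1 by blast
  then have "l \<le> u" using mem by simp
  then show "level a \<alpha> = {lower_end a \<alpha>..upper_end a \<alpha>}" "lower_end a \<alpha> \<le> upper_end a \<alpha>"
    by (simp_all add: lower_end_def upper_end_def lu)
qed

section \<open>Derivatives of fuzzy-valued functions\<close>

definition defines_fuzzy_number :: "(real \<Rightarrow> real set) \<Rightarrow> (real \<Rightarrow> real) \<Rightarrow> bool" where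
  "defines_fuzzy_number A u \<longleftrightarrow> u \<in> fuzzy_numbers \<and> (\<forall>\<alpha>\<in>{0..1}. level u \<alpha> = A \<alpha>)"

text \<open>
  Derivatives are taken within the interval \<open>I\<close>, hence are one-sided at endpoints that belong to
  \<open>I\<close>. The interval \<open>{d1 \<alpha>..d2 \<alpha>}\<close> is empty when \<open>d1 \<alpha> > d2 \<alpha>\<close>; such a family
  defines no fuzzy number, because level sets of fuzzy numbers are nonempty.
\<close>

definition has_S_derivative ::
    "(real \<Rightarrow> real \<Rightarrow> real) \<Rightarrow> (real \<Rightarrow> real) \<Rightarrow> real \<Rightarrow> real set \<Rightarrow> bool" where
  "has_S_derivative f u t I \<longleftrightarrow>
     (\<exists>d1 d2. (\<forall>\<alpha>\<in>{0..1}.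
                 ((\<lambda>s. lower_end (f s) \<alpha>) has_real_derivative d1 \<alpha>) (at t within I) \<and>
                 ((\<lambda>s. upper_end (f s) \<alpha>) has_real_derivative d2 \<alpha>) (at t within I)) \<and>
              defines_fuzzy_number (\<lambda>\<alpha>. {d1 \<alpha>..d2 \<alpha>}) u)"

definition S_differentiable_on :: "(real \<Rightarrow> real \<Rightarrow> real) \<Rightarrow> real set \<Rightarrow> bool" where
  "S_differentiable_on f I \<longleftrightarrow> (\<forall>t\<in>I. \<exists>u. has_S_derivative f u t I)"

definition has_gS_derivative ::
    "(real \<Rightarrow> real \<Rightarrow> real) \<Rightarrow> (real \<Rightarrow> real) \<Rightarrow> real \<Rightarrow> real set \<Rightarrow> bool" where
  "has_gS_derivative f u t I \<longleftrightarrow>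
     (\<exists>d1 d2. (\<forall>\<alpha>\<in>{0..1}.
                 ((\<lambda>s. lower_end (f s) \<alpha>) has_real_derivative d1 \<alpha>) (at t within I) \<and>
                 ((\<lambda>s. upper_end (f s) \<alpha>) has_real_derivative d2 \<alpha>) (at t within I)) \<and>
              defines_fuzzy_number (\<lambda>\<alpha>. {min (d1 \<alpha>) (d2 \<alpha>)..max (d1 \<alpha>) (d2 \<alpha>)}) u)"

definition gS_differentiable_on :: "(real \<Rightarrow> real \<Rightarrow> real) \<Rightarrow> real set \<Rightarrow> bool" where
  "gS_differentiable_on f I \<longleftrightarrow> (\<forall>t\<in>I. \<exists>u. has_gS_derivative f u t I)"

end

theory Submission
  imports Defs
begin

text \<open>
  The two notions ask for the same derivatives of the endpoint functions and differ only in whether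
  these derivatives are put in increasing order before they bound an interval. The Seikkala
  condition already forces this order: every interval of a family that defines a fuzzy number is one
  of its level sets, hence nonempty. So both families coincide, and the derivative itself is the
  same fuzzy number.
\<close>

lemma defines_fuzzy_number_imp_ordered:
  assumes "defines_fuzzy_number (\<lambda>\<alpha>. {l \<alpha>..r \<alpha>}) u" "\<alpha> \<in> {0..1}"
  shows "l \<alpha> \<le> r \<alpha>"
proof -
  have u: "u \<in> fuzzy_numbers" and "level u \<alpha> = {l \<alpha>..r \<alpha>}"
    using assms by (auto simp: defines_fuzzy_number_def)
  then have "{l \<alpha>..r \<alpha>} = {lower_end u \<alpha>..upper_end u \<alpha>}"
    using level_eq_interval(1)[OF u assms(2)] by metis
  also have "\<dots> \<noteq> {}"
    using level_eq_interval(2)[OF u assms(2)] by simp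
  finally show ?thesis by simp
qed

lemma has_S_derivative_imp_has_gS_derivative:
  assumes "has_S_derivative f u t I"
  shows "has_gS_derivative f u t I"
proof -
  obtain d1 d2 where
    deriv: "\<forall>\<alpha>\<in>{0..1}.
        ((\<lambda>s. lower_end (f s) \<alpha>) has_real_derivative d1 \<alpha>) (at t within I) \<and>
        ((\<lambda>s. upper_end (f s) \<alpha>) has_real_derivative d2 \<alpha>) (at t within I)"
    and fuzzy: "defines_fuzzy_number (\<lambda>\<alpha>. {d1 \<alpha>..d2 \<alpha>}) u"
    using assms unfolding has_S_derivative_def by blast
  have "min (d1 \<alpha>) (d2 \<alpha>) = d1 \<alpha> \<and> max (d1 \<alpha>) (d2 \<alpha>) = d2 \<alpha>" if "\<alpha> \<in> {0..1}" for \<alpha>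
    using defines_fuzzy_number_imp_ordered[OF fuzzy that] by simp
  then have "defines_fuzzy_number (\<lambda>\<alpha>. {min (d1 \<alpha>) (d2 \<alpha>)..max (d1 \<alpha>) (d2 \<alpha>)}) u"
    using fuzzy by (simp add: defines_fuzzy_number_def)
  with deriv show ?thesis
    unfolding has_gS_derivative_def by blast
qed

theorem theorem3p1:
  fixes I :: "real set" and f :: "real \<Rightarrow> real \<Rightarrow> real"
  assumes "is_interval I"
    and "\<forall>t\<in>I. f t \<in> fuzzy_numbers"
    and "S_differentiable_on f I"
  shows "gS_differentiable_on f I"
  using assms(3) has_S_derivative_imp_has_gS_derivative
  unfolding S_differentiable_on_def gS_differentiable_on_def by blast

end
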